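(* Let $L$ be a Noether lattice. Let $0\neq p\in L$ be a non-nilpotent proper element satisfying the restricted cancellation law. Let $b\in L$ be such that $p<b$. Then $b$ is $\phi$-$\delta$-primary to $p$ for some function $\phi:L\to L$ satisfying $\phi\leqslant\phi_n$ for all $n\geqslant 2$ if and only if $b$ is $\delta$-primary to $p$.
   Context: A multiplicative lattice is a complete lattice (least element $0$, largest element $1$) with a commutative, associative multiplication that distributes over arbitrary joins and has $1$ as multiplicative identity. An element $a$ is compact if whenever $a\leqslant \vee X$ for $X\subseteq L$ there are finitely many $a_1,\dots,a_n\in X$ with $a\leqslant a_1\vee\cdots\vee a_n$. Standing assumptions: $L$ is a compactly generated multiplicative lattice (every element is a join of compact elements), $1$ is compact, and every finite product of compact elements is compact. For $a,b\in L$, $(a:b)=\vee\{x\in L\mid xb\leqslant a\}$. An element $e$ is principal if it is meet principal ($a\wedge be=((a:e)\wedge b)e$ for all $a,b$) and join principal ($(ae\vee b):e=(b:e)\vee a$ for all $a,b$). A Noether lattice is a multiplicative lattice that is modular, principally generated (every element is a join of principal elements) and satisfies the ascending chain condition. An element $a$ satisfies the restricted cancellation law if for all $b,c\in L$, $ab=ac\neq 0$ implies $b=c$. An element $p$ is proper if $p<1$, and non-nilpotent if $p^n\neq 0$ for all positive integers $n$. $\delta:L\to L$ is an expansion function: $a\leqslant\delta(a)$ for all $a$, and $a\leqslant b$ implies $\delta(a)\leqslant\delta(b)$. An element $b$ is $\delta$-primary to a proper element $p$ if for all $x\in L$, $xb\leqslant p$ implies $x\leqslant\delta(p)$. For $\phi:L\to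 L$, $b$ is $\phi$-$\delta$-primary to a proper element $p$ if for all $x\in L$, $xb\leqslant p$ and $xb\not\leqslant\phi(p)$ implies $x\leqslant\delta(p)$. $\phi_n(q)=q^n$ for $n\geqslant 2$. For functions $\gamma_1,\gamma_2:L\to L$, $\gamma_1\leqslant\gamma_2$ means $\gamma_1(a)\leqslant\gamma_2(a)$ for every $a\in L$. *)

theory Defs
  imports Main
begin

text \<open>
  The least and largest elements of the lattice are written \<open>bot\<close> and \<open>1\<close>.
  In \<open>mult_Sup\<close> the set \<open>X\<close> may be empty, so that \<open>a * bot = bot\<close>.
\<close>

class multiplicative_lattice = complete_lattice + comm_monoid_mult +
  assumes one_eq_top: "1 = top"
    and mult_Sup: "a * Sup X = Sup {a * x |x. x \<in> X}"

definition (in complete_lattice) compact_element :: "'a \<Rightarrow> bool" where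
  "compact_element a \<longleftrightarrow>
     (\<forall>X. a \<le> Sup X \<longrightarrow> (\<exists>F. finite F \<and> F \<subseteq> X \<and> a \<le> Sup F))"

class compactly_generated_multiplicative_lattice = multiplicative_lattice +
  assumes compactly_generated: "\<exists>X. (\<forall>x\<in>X. compact_element x) \<and> a = Sup X"
    and compact_one: "compact_element 1"
    and compact_prod: "(\<forall>x\<in>set xs. compact_element x) \<Longrightarrow> compact_element (prod_list xs)"

context multiplicative_lattice
begin

definition residual :: "'a \<Rightarrow> 'a \<Rightarrow> 'a" where
  "residual a b = Sup {x. x * b \<le> a}"

definition meet_principal :: "'a \<Rightarrow> bool" where
  "meet_principal e \<longleftrightarrow> (\<forall>a b. inf a (b * e) = inf (residual a e) b * e)"

definition join_principal :: "'a \<Rightarrow> bool" where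
  "join_principal e \<longleftrightarrow> (\<forall>a b. residual (sup (a * e) b) e = sup (residual b e) a)"

definition principal :: "'a \<Rightarrow> bool" where
  "principal e \<longleftrightarrow> meet_principal e \<and> join_principal e"

end

class noether_lattice = multiplicative_lattice +
  assumes modular: "x \<le> z \<Longrightarrow> sup x (inf y z) = inf (sup x y) z"
    and principally_generated: "\<exists>X. (\<forall>x\<in>X. principal x) \<and> a = Sup X"
    and ascending_chain_condition:
      "(\<forall>n::nat. f n \<le> f (Suc n)) \<Longrightarrow> \<exists>N. \<forall>n\<ge>N. f n = f N"

context multiplicative_lattice
begin

definition restricted_cancellation :: "'a \<Rightarrow> bool" where
  "restricted_cancellation a \<longleftrightarrow> (\<forall>b c. a * b = a * c \<and> a * c \<noteq> bot \<longrightarrow> b = c)"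

definition proper :: "'a \<Rightarrow> bool" where
  "proper p \<longleftrightarrow> p < 1"

definition non_nilpotent :: "'a \<Rightarrow> bool" where
  "non_nilpotent p \<longleftrightarrow> (\<forall>n::nat. n > 0 \<longrightarrow> p ^ n \<noteq> bot)"

definition expansion_function :: "('a \<Rightarrow> 'a) \<Rightarrow> bool" where
  "expansion_function \<delta> \<longleftrightarrow> (\<forall>a. a \<le> \<delta> a) \<and> (\<forall>a b. a \<le> b \<longrightarrow> \<delta> a \<le> \<delta> b)"

definition delta_primary_to :: "('a \<Rightarrow> 'a) \<Rightarrow> 'a \<Rightarrow> 'a \<Rightarrow> bool" where
  "delta_primary_to \<delta> b p \<longleftrightarrow> proper p \<and> (\<forall>x. x * b \<le> p \<longrightarrow> x \<le> \<delta> p)"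

definition phi_delta_primary_to :: "('a \<Rightarrow> 'a) \<Rightarrow> ('a \<Rightarrow> 'a) \<Rightarrow> 'a \<Rightarrow> 'a \<Rightarrow> bool" where
  "phi_delta_primary_to \<phi> \<delta> b p \<longleftrightarrow>
     proper p \<and> (\<forall>x. x * b \<le> p \<and> \<not> x * b \<le> \<phi> p \<longrightarrow> x \<le> \<delta> p)"

definition phi_pow :: "nat \<Rightarrow> 'a \<Rightarrow> 'a" where
  "phi_pow n q = q ^ n"

end

end

theory Submission
  imports Defs
begin

text \<open>
  Replacing \<open>x\<close> by \<open>sup x p\<close> reduces the claim to excluding \<open>p * b \<le> \<phi> p\<close>. As \<open>\<phi> p \<le> p * p \<le> p * b\<close>,
  that would give \<open>p * b = p * p \<noteq> bot\<close>, and cancelling \<open>p\<close> would contradict \<open>p < b\<close>.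
\<close>

context multiplicative_lattice
begin

lemma mult_sup_distrib: "a * sup x y = sup (a * x) (a * y)"
proof -
  have "{a * z |z. z \<in> {x, y}} = {a * x, a * y}"
    by auto
  then show ?thesis
    using mult_Sup[of a "{x, y}"] by simp
qed

lemma mult_left_mono_lattice: "x \<le> y \<Longrightarrow> a * x \<le> a * y"
  using mult_sup_distrib[of a x y] by (simp add: le_iff_sup)

lemma mult_le_left: "a * x \<le> a"
proof -
  have "x \<le> 1"
    by (simp add: one_eq_top)
  then show ?thesis
    using mult_left_mono_lattice[of x 1 a] by simp
qed

lemma delta_primary_to_if_phi_delta_primary_to:
  assumes phi: "phi_delta_primary_to \<phi> \<delta> b p" and "\<phi> p \<le> p * p"
    and "p * p \<noteq> bot" and "restricted_cancellation p" and "p < b"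
  shows "delta_primary_to \<delta> b p"
  unfolding delta_primary_to_def
proof (intro conjI allI impI)
  show "proper p"
    using phi by (simp add: phi_delta_primary_to_def)
next
  fix x
  assume "x * b \<le> p"
  \<comment> \<open>The product \<open>x * b\<close> itself may lie below \<open>\<phi> p\<close>,
    where the hypothesis is silent. Joining \<open>p\<close> to \<open>x\<close> adds the term
    \<open>p * b\<close>, which stays below \<open>p\<close> but escapes
    \<open>\<phi> p\<close>.\<close>
  have eq: "sup x p * b = sup (x * b) (p * b)"
    using mult_sup_distrib[of b x p] by (simp add: mult.commute)
  have "\<not> p * b \<le> \<phi> p"
  proof
    assume "p * b \<le> \<phi> p"
    then have "p * b \<le> p * p"
      using \<open>\<phi> p \<le> p * p\<close> by (rule order_trans)
    moreover have "p * p \<le> p * b"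
      using \<open>p < b\<close> by (intro mult_left_mono_lattice less_imp_le)
    ultimately have "p * b = p * p"
      by (rule order.antisym)
    \<comment> \<open>Only nonzero products can be cancelled; here the common product is
      \<open>p * p\<close>.\<close>
    then have "b = p"
      using assms(3,4) unfolding restricted_cancellation_def by blast
    with \<open>p < b\<close> show False
      by simp
  qed
  \<comment> \<open>A join lies below \<open>\<phi> p\<close> only if both of its terms do, and
    \<open>p * b\<close> does not.\<close>
  then have "\<not> sup x p * b \<le> \<phi> p"
    by (simp add: eq)
  moreover have "sup x p * b \<le> p"
    using \<open>x * b \<le> p\<close> by (simp add: eq mult_le_left)
  ultimately have "sup x p \<le> \<delta> p"
    using phi unfolding phi_delta_primary_to_def by blast
  then show "x \<le> \<delta> p"
    by simp
qed

end

theorem theorem2p19: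
  fixes p b :: "'a :: {compactly_generated_multiplicative_lattice, noether_lattice}"
    and \<delta> :: "'a \<Rightarrow> 'a"
  assumes "expansion_function \<delta>"
    and "p \<noteq> bot"
    and "non_nilpotent p"
    and "proper p"
    and "restricted_cancellation p"
    and "p < b"
  shows "(\<exists>\<phi> :: 'a \<Rightarrow> 'a. (\<forall>n\<ge>2. \<phi> \<le> phi_pow n) \<and> phi_delta_primary_to \<phi> \<delta> b p)
     \<longleftrightarrow> delta_primary_to \<delta> b p"
proof
  assume "\<exists>\<phi> :: 'a \<Rightarrow> 'a. (\<forall>n\<ge>2. \<phi> \<le> phi_pow n) \<and> phi_delta_primary_to \<phi> \<delta> b p"
  \<comment> \<open>The exponent 2 gives the bound \<open>p * p\<close>, which can be compared with
    \<open>p * b\<close> by cancelling a single factor \<open>p\<close>.\<close>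
  then obtain \<phi> :: "'a \<Rightarrow> 'a" where "\<phi> \<le> phi_pow 2" and phi: "phi_delta_primary_to \<phi> \<delta> b p"
    by blast
  then have "\<phi> p \<le> p * p"
    by (simp add: le_fun_def phi_pow_def power2_eq_square)
  moreover have "p * p \<noteq> bot"
    using \<open>non_nilpotent p\<close> unfolding non_nilpotent_def
    by (metis power2_eq_square zero_less_numeral)
  ultimately show "delta_primary_to \<delta> b p"
    using phi assms(5,6) by (intro delta_primary_to_if_phi_delta_primary_to)
next
  assume "delta_primary_to \<delta> b p"
  \<comment> \<open>Here \<open>bot\<close> is the constant zero function, the least element of the
    pointwise order and so below every \<open>phi_pow n\<close>. Excluding the \<open>x\<close> with
    \<open>x * b \<le> bot\<close> only weakens the condition.\<close>
  then have "phi_delta_primary_to bot \<delta> b p"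
    by (simp add: delta_primary_to_def phi_delta_primary_to_def)
  then show "\<exists>\<phi> :: 'a \<Rightarrow> 'a. (\<forall>n\<ge>2. \<phi> \<le> phi_pow n) \<and> phi_delta_primary_to \<phi> \<delta> b p"
    by (intro exI[of _ bot]) simp
qed

end
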